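(* Every full layered $T$-system is a maximal green sequence. That is, if $B=B_1\xrightarrow{k_1}B_2\xrightarrow{k_2}\cdots\xrightarrow{k_r}B_{r+1}$ is a sequence of mutations of skew-symmetrizable matrices in $M_{\mathbf{ex},\mathbf{ex}}(\mathbb Z)$ which is a full layered $T$-system for some function $\eta:\mathbf{ex}\to\mathbb Z$, then $k_1,\dots,k_r$ is a maximal green sequence for $B$.
   Context: **Matrices, valued quivers, mutation.** $\mathbf{ex}\subseteq[1,N]$ is a finite totally ordered set (order induced from the integers). $B\in M_{\mathbf{ex},\mathbf{ex}}(\mathbb Z)$ is skew-symmetrizable: there is a diagonal matrix $D$ with positive integer diagonal entries such that $DB$ is skew-symmetric. Mutation at $k$: $\mu_k(b_{ij})=(b'_{ij})$ with $b'_{ij}=-b_{ij}$ if $i=k$ or $j=k$, and $b'_{ij}=b_{ij}+\frac{|b_{ik}|b_{kj}+b_{ik}|b_{kj}|}{2}$ otherwise (the same formula applies to matrices with additional frozen rows, with $k\in\mathbf{ex}$). $B\xrightarrow{k}B'$ means $B'=\mu_k(B)$. For an index set $I=\mathbf{ex}\sqcup\mathbf{fr}$ and $\widetilde B\in M_{I,\mathbf{ex}}(\mathbb Z)$ with skew-symmetrizable $\mathbf{ex}\times\mathbf{ex}$ part, set $b_{ji}:=-b_{ij}$ for $i\in\mathbf{fr},j\in\mathbf{ex}$; the valued ice quiver $Q(\widetilde B)$ has vertex set $I$ and an arrow $i\to j$ whenever $b_{ij}<0$ (equivalently $b_{ji}>0$), labeled by $(|b_{ij}|,|b_{ji}|)$;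 an arrow labeled $(1,1)$ is called simple and written without label. **Green sequences.** Let $\mathbf{ex}'=\{i':i\in\mathbf{ex}\}$, $\widehat B=\begin{bmatrix}B\\ \mathrm{Id}\end{bmatrix}\in M_{\mathbf{ex}\sqcup\mathbf{ex}',\mathbf{ex}}(\mathbb Z)$; its valued ice quiver is the framed quiver $\widehat{Q(B)}$ obtained from $Q(B)$ by adding frozen vertices $i'$ and simple arrows $i\to i'$, $i\in\mathbf{ex}$. The $c$-vector of $j\in\mathbf{ex}$ after mutating along $k_1,\dots,k_i$ is the $\mathbf{ex}'$-part of the $j$-th column of $\mu_{k_i}\cdots\mu_{k_1}(\widehat B)$; $j$ is green (red) if all coordinates of its $c$-vector are $\ge0$ ($\le0$). A sequence $k_1,\dots,k_n$ is a maximal green sequence for $B$ if for all $1\le i\le n$, $k_i$ is green for $\mu_{k_{i-1}}\cdots\mu_{k_1}(B)$, and all $j\in\mathbf{ex}$ are red for $\mu_{k_n}\cdots\mu_{k_1}(B)$. **Layered $T$-systems.** For $\eta:\mathbf{ex}\to\mathbb Z$ and $k\in\mathbf{ex}$, let $k[-1]$ be the largest $j\in\mathbf{ex}$, $j<k$, with $\eta(j)=\eta(k)$ ($-\infty$ if none), and $k[1]$ the smallest $j\in\mathbf{ex}$, $j>k$, with $\eta(j)=\eta(k)$ ($\infty$ if none). A sequence of mutations $B=B_1\xrightarrow{k_1}B_2\xrightarrow{k_2}\cdots\xrightarrow{k_r}B_{r+1}$ in $M_{\mathbf{ex},\mathbf{ex}}(\mathbb Z)$ is a layered $T$-system (for $\eta$)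 if for all $1\le i\le r$: (1) the incoming arrows to $k_i$ in $Q(B_i)$ are exactly one simple arrow from each of those among $k_i[-1]$, $k_i[1]$ that are finite; (2) the outgoing arrows from $k_i$ in $Q(B_i)$ (with arbitrary labels) go only to vertices $j$ with $\eta(j)\ne\eta(k_i)$. For $t\in\mathrm{range}(\eta)$ write $\eta^{-1}(t)=\{j_{t,1}<\dots<j_{t,\ell(t)}\}$. The layered $T$-system is full if for every $t\in\mathrm{range}(\eta)$ the subsequence of $(k_1,\dots,k_r)$ consisting of the indices in $\eta^{-1}(t)$ is a shuffle of the $\ell(t)$ lists (rows), the $n$-th row being $j_{t,1},j_{t,2},\dots,j_{t,\ell(t)+1-n}$ for $1\le n\le\ell(t)$, such that the entry $j_{t,i}$ of the $n$-th row comes after the entry $j_{t,i+1}$ of the $(n-1)$-st row (for $n\ge2$). In other words, the entries of the subsequence can be labeled bijectively by pairs $(n,i)$, $1\le n\le\ell(t)$, $1\le i\le\ell(t)+1-n$, so that the $(n,i)$ entry equals $j_{t,i}$, $(n,i)$ precedes $(n,i+1)$, and $(n,i)$ comes after $(n-1,i+1)$ for $n\geq 2$. *)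

theory Defs
  imports Main
begin

text \<open>
  An integer matrix is a function of its row and column index; only the entries at indices in the
  carrier at hand are meaningful. A matrix with rows in \<open>ex\<close> plus frozen rows and columns in
  \<open>ex\<close> is rendered as a matrix over the common row index type whose frozen columns are junk:
  for non-frozen \<open>k\<close> and \<open>j\<close>, column \<open>j\<close> of \<open>mutate k b\<close> depends only on columns \<open>j\<close> and \<open>k\<close>
  of \<open>b\<close>. The division by 2 in \<open>mutate\<close> is exact, since |x| y + x |y| is always even.
\<close>

type_synonym 'i mat = "'i \<Rightarrow> 'i \<Rightarrow> int"

definition skew_symmetrizable :: "'i set \<Rightarrow> 'i mat \<Rightarrow> bool" where
  "skew_symmetrizable ex b \<longleftrightarrow>
     (\<exists>d :: 'i \<Rightarrow> int. (\<forall>i\<in>ex. d i > 0) \<and> (\<forall>i\<in>ex. \<forall>j\<in>ex. d i * b i j = - (d j * b j i)))"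

definition mutate :: "'i \<Rightarrow> 'i mat \<Rightarrow> 'i mat" where
  "mutate k b = (\<lambda>i j. if i = k \<or> j = k then - b i j
                      else b i j + (\<bar>b i k\<bar> * b k j + b i k * \<bar>b k j\<bar>) div 2)"

text \<open>The head of the list is mutated first.\<close>

definition mutate_seq :: "'i list \<Rightarrow> 'i mat \<Rightarrow> 'i mat" where
  "mutate_seq ks b = fold mutate ks b"

text \<open>
  The arrows of the valued quiver with vertex set \<open>ex\<close>, as triples (source, label, target).
  The direction convention is that negative entries \<open>b i j\<close> give arrows from \<open>i\<close> to \<open>j\<close>.
\<close>

definition arrows :: "'i set \<Rightarrow> 'i mat \<Rightarrow> ('i \<times> (int \<times> int) \<times> 'i) set" where
  "arrows ex b = {(i, (\<bar>b i j\<bar>, \<bar>b j i\<bar>), j) | i j. i \<in> ex \<and> j \<in> ex \<and> b i j < 0}"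

definition incoming :: "'i set \<Rightarrow> 'i mat \<Rightarrow> 'i \<Rightarrow> ('i \<times> (int \<times> int) \<times> 'i) set" where
  "incoming ex b k = {(i, l, j) \<in> arrows ex b. j = k}"

definition outgoing :: "'i set \<Rightarrow> 'i mat \<Rightarrow> 'i \<Rightarrow> ('i \<times> (int \<times> int) \<times> 'i) set" where
  "outgoing ex b k = {(i, l, j) \<in> arrows ex b. i = k}"

text \<open>The frozen copy of the index \<open>i\<close> is \<open>Inr i\<close>. The junk columns are padded with zeros.\<close>

fun framed :: "'i mat \<Rightarrow> ('i + 'i) mat" where
  "framed b (Inl i) (Inl j) = b i j"
| "framed b (Inr i) (Inl j) = (if i = j then 1 else 0)"
| "framed b _ (Inr j) = 0"

definition c_vector :: "'i mat \<Rightarrow> 'i list \<Rightarrow> 'i \<Rightarrow> 'i \<Rightarrow> int" where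
  "c_vector b ks j = (\<lambda>i. mutate_seq (map Inl ks) (framed b) (Inr i) (Inl j))"

definition green :: "'i set \<Rightarrow> 'i mat \<Rightarrow> 'i list \<Rightarrow> 'i \<Rightarrow> bool" where
  "green ex b ks j \<longleftrightarrow> (\<forall>i\<in>ex. c_vector b ks j i \<ge> 0)"

definition red :: "'i set \<Rightarrow> 'i mat \<Rightarrow> 'i list \<Rightarrow> 'i \<Rightarrow> bool" where
  "red ex b ks j \<longleftrightarrow> (\<forall>i\<in>ex. c_vector b ks j i \<le> 0)"

definition maximal_green_sequence :: "'i set \<Rightarrow> 'i mat \<Rightarrow> 'i list \<Rightarrow> bool" where
  "maximal_green_sequence ex b ks \<longleftrightarrow>
     set ks \<subseteq> ex \<and>
     (\<forall>i < length ks. green ex b (take i ks) (ks ! i)) \<and>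
     (\<forall>j\<in>ex. red ex b ks j)"

text \<open>The indices \<open>k[-1]\<close> and \<open>k[1]\<close>; \<open>None\<close> stands for the infinite values.\<close>

definition pred_idx :: "nat set \<Rightarrow> (nat \<Rightarrow> int) \<Rightarrow> nat \<Rightarrow> nat option" where
  "pred_idx ex \<eta> k =
     (let S = {j\<in>ex. j < k \<and> \<eta> j = \<eta> k} in if S = {} then None else Some (Max S))"

definition succ_idx :: "nat set \<Rightarrow> (nat \<Rightarrow> int) \<Rightarrow> nat \<Rightarrow> nat option" where
  "succ_idx ex \<eta> k =
     (let S = {j\<in>ex. j > k \<and> \<eta> j = \<eta> k} in if S = {} then None else Some (Min S))"

text \<open>
  The sequence of matrices is determined by its first member \<open>b\<close> and the mutation directions
  \<open>ks\<close>; the matrix to which the mutation at \<open>ks ! i\<close> is applied is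
  \<open>mutate_seq (take i ks) b\<close>.
\<close>

definition layered_T_system :: "nat set \<Rightarrow> (nat \<Rightarrow> int) \<Rightarrow> nat mat \<Rightarrow> nat list \<Rightarrow> bool" where
  "layered_T_system ex \<eta> b ks \<longleftrightarrow>
     set ks \<subseteq> ex \<and>
     (\<forall>i < length ks. let k = ks ! i; b' = mutate_seq (take i ks) b in
        incoming ex b' k =
          {(j, (1, 1), k) | j. pred_idx ex \<eta> k = Some j \<or> succ_idx ex \<eta> k = Some j} \<and>
        (\<forall>(_, _, j) \<in> outgoing ex b' k. \<eta> j \<noteq> \<eta> k))"

definition layer_size :: "nat set \<Rightarrow> (nat \<Rightarrow> int) \<Rightarrow> int \<Rightarrow> nat" where
  "layer_size ex \<eta> t = card {j\<in>ex. \<eta> j = t}"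

text \<open>\<open>layer_elem ex \<eta> t i\<close> is \<open>j\<^sub>t\<^sub>,\<^sub>i\<close>, for \<open>i\<close> from 1 to \<open>layer_size ex \<eta> t\<close>.\<close>

definition layer_elem :: "nat set \<Rightarrow> (nat \<Rightarrow> int) \<Rightarrow> int \<Rightarrow> nat \<Rightarrow> nat" where
  "layer_elem ex \<eta> t i = sorted_list_of_set {j\<in>ex. \<eta> j = t} ! (i - 1)"

definition triangle :: "nat \<Rightarrow> (nat \<times> nat) set" where
  "triangle l = {(n, i). 1 \<le> n \<and> n \<le> l \<and> 1 \<le> i \<and> i \<le> l + 1 - n}"

text \<open>
  The list \<open>ks\<close> is a shuffle of the rows \<open>j 1, ..., j (l + 1 - n)\<close>, where \<open>pos (n, i)\<close> is the
  position in \<open>ks\<close> of the \<open>i\<close>-th entry of the \<open>n\<close>-th row.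
\<close>

definition triangular_shuffle :: "nat \<Rightarrow> (nat \<Rightarrow> nat) \<Rightarrow> nat list \<Rightarrow> bool" where
  "triangular_shuffle l j ks \<longleftrightarrow>
     (\<exists>pos :: nat \<times> nat \<Rightarrow> nat.
        bij_betw pos (triangle l) {..<length ks} \<and>
        (\<forall>(n, i) \<in> triangle l. ks ! pos (n, i) = j i) \<and>
        (\<forall>(n, i) \<in> triangle l. (n, i + 1) \<in> triangle l \<longrightarrow> pos (n, i) < pos (n, i + 1)) \<and>
        (\<forall>(n, i) \<in> triangle l. n \<ge> 2 \<longrightarrow> pos (n - 1, i + 1) < pos (n, i)))"

definition full_layered_T_system :: "nat set \<Rightarrow> (nat \<Rightarrow> int) \<Rightarrow> nat mat \<Rightarrow> nat list \<Rightarrow> bool" where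
  "full_layered_T_system ex \<eta> b ks \<longleftrightarrow>
     layered_T_system ex \<eta> b ks \<and>
     (\<forall>t \<in> \<eta> ` ex.
        triangular_shuffle (layer_size ex \<eta> t) (layer_elem ex \<eta> t) (filter (\<lambda>k. \<eta> k = t) ks))"

end

theory Submission
  imports Defs
begin

text \<open>
  At a green vertex \<open>k\<close> the incoming arrows alone determine how the c-vectors change, so in a layered
  \<open>T\<close>-system the c-vector of \<open>k\<close> is negated and added to those of \<open>k[-1]\<close> and \<open>k[1]\<close>, whatever the
  other layers do. Within a layer with \<open>l\<close> elements this is right multiplication \<open>w \<mapsto> w s\<^sub>i\<close> in the
  symmetric group on \<open>l + 1\<close> letters, the c-vector of \<open>j\<^sub>p\<close> being the root \<open>w(\<alpha>\<^sub>p)\<close>. The triangular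
  shuffles are reduced words of the longest element: every step is taken at a positive root, and
  at the end all simple roots have been sent to negative ones.
\<close>

section \<open>Mutation of skew-symmetrizable matrices\<close>

lemma even_abs_mult_add: "even (\<bar>x\<bar> * y + x * \<bar>y\<bar>)" for x y :: int
  by (cases "x \<ge> 0"; cases "y \<ge> 0") auto

text \<open>The same symmetrizer \<open>d\<close> survives:
  \<open>d i * \<bar>b i k\<bar> = d k * \<bar>b k i\<bar>\<close> and its signed analogue carry the
  factor from \<open>i\<close> through \<open>k\<close> to \<open>j\<close>, with one change of
  sign.\<close>

lemma mutate_skew:
  fixes d :: "'i \<Rightarrow> int"
  assumes pos: "\<And>i. i \<in> ex \<Longrightarrow> d i > 0"
    and skew: "\<And>i j. i \<in> ex \<Longrightarrow> j \<in> ex \<Longrightarrow> d i * b i j = - (d j * b j i)"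
    and ij: "i \<in> ex" "j \<in> ex" "k \<in> ex"
  shows "d i * mutate k b i j = - (d j * mutate k b j i)"
proof (cases "i = k \<or> j = k")
  case True
  then show ?thesis using skew[OF ij(1,2)] by (auto simp: mutate_def)
next
  case False
  define X where "X = \<bar>b i k\<bar> * b k j + b i k * \<bar>b k j\<bar>"
  define Y where "Y = \<bar>b j k\<bar> * b k i + b j k * \<bar>b k i\<bar>"
  have abs_skew: "d x * \<bar>b x y\<bar> = d y * \<bar>b y x\<bar>" if "x \<in> ex" "y \<in> ex" for x y
    using arg_cong[OF skew[OF that], of abs] pos[OF that(1)] pos[OF that(2)]
    by (simp add: abs_mult)
  have "d i * X = (d i * \<bar>b i k\<bar>) * b k j + (d i * b i k) * \<bar>b k j\<bar>"
    by (simp add: X_def algebra_simps)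
  also have "\<dots> = \<bar>b k i\<bar> * (d k * b k j) - b k i * (d k * \<bar>b k j\<bar>)"
    using abs_skew[OF ij(1,3)] skew[OF ij(1,3)] by (simp add: algebra_simps)
  also have "\<dots> = - (d j * Y)"
    using abs_skew[OF ij(3,2)] skew[OF ij(3,2)] by (simp add: Y_def algebra_simps)
  finally have "d i * X = - (d j * Y)" .
  \<comment> \<open>Both numerators are even, so the identity between them can be halved.\<close>
  moreover have "X = 2 * (X div 2)" "Y = 2 * (Y div 2)"
    unfolding X_def Y_def by (simp_all add: even_abs_mult_add)
  ultimately have "2 * (d i * (X div 2)) = 2 * (- (d j * (Y div 2)))"
    by (metis mult.left_commute mult_minus_right)
  then have "d i * (X div 2) = - (d j * (Y div 2))" by simp
  moreover have "mutate k b i j = b i j + X div 2" "mutate k b j i = b j i + Y div 2"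
    using False by (auto simp: mutate_def X_def Y_def)
  ultimately show ?thesis
    using skew[OF ij(1,2)] by (simp add: distrib_left)
qed

lemma skew_symmetrizable_mutate:
  assumes "skew_symmetrizable ex b" "k \<in> ex"
  shows "skew_symmetrizable ex (mutate k b)"
proof -
  obtain d where "\<forall>i\<in>ex. d i > 0" "\<forall>i\<in>ex. \<forall>j\<in>ex. d i * b i j = - (d j * b j i)"
    using assms(1) unfolding skew_symmetrizable_def by blast
  then show ?thesis
    unfolding skew_symmetrizable_def using mutate_skew[of ex d b] assms(2) by blast
qed

lemma mutate_seq_snoc: "mutate_seq (ks @ [k]) b = mutate k (mutate_seq ks b)"
  by (simp add: mutate_seq_def)

lemma skew_symmetrizable_mutate_seq:
  assumes "skew_symmetrizable ex b" "set ks \<subseteq> ex"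
  shows "skew_symmetrizable ex (mutate_seq ks b)"
  using assms(2)
proof (induction ks rule: rev_induct)
  case Nil
  then show ?case using assms(1) by (simp add: mutate_seq_def)
next
  case (snoc k ks)
  then show ?case by (simp add: mutate_seq_snoc skew_symmetrizable_mutate)
qed

text \<open>Arrows into \<open>k\<close> are recorded by negative entries of column
  \<open>k\<close>, whereas c-vectors change by the positive entries of row \<open>k\<close>; this
  translates between the two.\<close>

lemma skew_symmetrizable_pos_iff:
  assumes "skew_symmetrizable ex b" "i \<in> ex" "j \<in> ex"
  shows "b i j > 0 \<longleftrightarrow> b j i < 0"
proof -
  obtain d where d: "\<forall>i\<in>ex. d i > 0" "\<forall>i\<in>ex. \<forall>j\<in>ex. d i * b i j = - (d j * b j i)"
    using assms(1) unfolding skew_symmetrizable_def by blast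
  have "b i j > 0 \<longleftrightarrow> d i * b i j > 0"
    using d(1) assms(2) by (auto simp: zero_less_mult_iff)
  also have "\<dots> \<longleftrightarrow> d j * b j i < 0" using d(2)[rule_format, OF assms(2,3)] by simp
  also have "\<dots> \<longleftrightarrow> b j i < 0" using d(1) assms(3) by (auto simp: mult_less_0_iff)
  finally show ?thesis .
qed

section \<open>Mutation of c-vectors\<close>

text \<open>The entry at \<open>i\<close>, \<open>j\<close> of a mutation at \<open>k\<close>
  involves rows \<open>i\<close> and \<open>k\<close> only, so frozen rows never feed back into the
  other rows.\<close>

lemma mutate_seq_framed:
  "mutate_seq (map Inl ks) (framed b) (Inl i) (Inl j) = mutate_seq ks b i j"
proof (induction ks arbitrary: i j rule: rev_induct)
  case Nil
  then show ?case by (simp add: mutate_seq_def)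
next
  case (snoc k ks)
  then show ?case by (simp add: mutate_seq_snoc mutate_def)
qed

lemma c_vector_Nil: "c_vector b [] j i = (if i = j then 1 else 0)"
  by (simp add: c_vector_def mutate_seq_def)

text \<open>For a nonnegative coordinate \<open>x\<close> of the c-vector of \<open>k\<close>, the
  term \<open>(x * y + x * \<bar>y\<bar>) div 2\<close> is \<open>x * max y 0\<close>: only arrows
  into \<open>k\<close> contribute.\<close>

lemma c_vector_snoc:
  assumes "c_vector b ks k i \<ge> 0"
  shows "c_vector b (ks @ [k]) j i =
    (if j = k then - c_vector b ks j i
     else c_vector b ks j i + c_vector b ks k i * max (mutate_seq ks b k j) 0)"
proof -
  have "(x * y + x * \<bar>y\<bar>) div 2 = x * max y 0" for x y :: int
    by (cases "y \<ge> 0") (auto simp: max_def)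
  then show ?thesis
    using assms
    by (simp add: c_vector_def mutate_seq_snoc mutate_def mutate_seq_framed)
qed

lemma layered_T_system_c_vector_step:
  assumes skew: "skew_symmetrizable ex b" and layered: "layered_T_system ex \<eta> b ks"
    and s: "s < length ks" and k: "k = ks ! s"
    and nonneg: "c_vector b (take s ks) k i \<ge> 0" and j: "j \<in> ex"
  shows "c_vector b (take (Suc s) ks) j i =
    (if j = k then - c_vector b (take s ks) j i
     else if pred_idx ex \<eta> k = Some j \<or> succ_idx ex \<eta> k = Some j
       then c_vector b (take s ks) j i + c_vector b (take s ks) k i
     else c_vector b (take s ks) j i)"
proof -
  define b' where "b' = mutate_seq (take s ks) b"
  have ks: "set ks \<subseteq> ex" and inc: "incoming ex b' k =
      {(j, (1, 1), k) | j. pred_idx ex \<eta> k = Some j \<or> succ_idx ex \<eta> k = Some j}"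
    using layered s k unfolding layered_T_system_def by (auto simp: Let_def b'_def)
  have kex: "k \<in> ex" using ks k s by auto
  have "skew_symmetrizable ex b'"
    unfolding b'_def
    by (rule skew_symmetrizable_mutate_seq[OF skew]) (use ks in \<open>auto dest: in_set_takeD\<close>)
  then have sgn: "b' k j > 0 \<longleftrightarrow> b' j k < 0"
    using skew_symmetrizable_pos_iff kex j by metis
  \<comment> \<open>The second label of an arrow from \<open>j\<close> to \<open>k\<close> is
    \<open>\<bar>b' k j\<bar>\<close>, so simplicity forces a positive entry to be 1.\<close>
  have "max (b' k j) 0 =
      (if pred_idx ex \<eta> k = Some j \<or> succ_idx ex \<eta> k = Some j then 1 else 0)"
  proof (cases "b' j k < 0")
    case True
    then have "(j, (\<bar>b' j k\<bar>, \<bar>b' k j\<bar>), k) \<in> incoming ex b' k"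
      using j kex by (auto simp: incoming_def arrows_def)
    with inc True sgn show ?thesis by auto
  next
    case False
    then have "(j, (1, 1), k) \<notin> incoming ex b' k"
      by (auto simp: incoming_def arrows_def)
    with inc False sgn show ?thesis by auto
  qed
  moreover have "take (Suc s) ks = take s ks @ [k]"
    using s k by (simp add: take_Suc_conv_app_nth)
  ultimately show ?thesis
    using c_vector_snoc[of b "take s ks" k i j] nonneg by (simp add: b'_def)
qed

section \<open>The elements of a layer\<close>

lemma layer_elem_strict_mono:
  assumes "finite ex" "1 \<le> p" "p < q" "q \<le> layer_size ex \<eta> t"
  shows "layer_elem ex \<eta> t p < layer_elem ex \<eta> t q"
  unfolding layer_elem_def
  by (rule sorted_wrt_nth_less[OF strict_sorted_list_of_set])
    (use assms in \<open>auto simp: layer_size_def\<close>)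

lemma layer_elem_less_iff:
  assumes "finite ex" "p \<in> {1..layer_size ex \<eta> t}" "q \<in> {1..layer_size ex \<eta> t}"
  shows "layer_elem ex \<eta> t p < layer_elem ex \<eta> t q \<longleftrightarrow> p < q"
  using assms layer_elem_strict_mono[of ex p q \<eta> t] layer_elem_strict_mono[of ex q p \<eta> t]
  by (cases p q rule: linorder_cases) auto

lemma layer_elem_eq_iff:
  assumes "finite ex" "p \<in> {1..layer_size ex \<eta> t}" "q \<in> {1..layer_size ex \<eta> t}"
  shows "layer_elem ex \<eta> t p = layer_elem ex \<eta> t q \<longleftrightarrow> p = q"
  using layer_elem_less_iff[OF assms] layer_elem_less_iff[OF assms(1,3,2)]
  by (metis less_irrefl nat_neq_iff)

lemma layer_elem_image:
  assumes "finite ex"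
  shows "layer_elem ex \<eta> t ` {1..layer_size ex \<eta> t} = {j\<in>ex. \<eta> j = t}"
proof -
  let ?xs = "sorted_list_of_set {j\<in>ex. \<eta> j = t}"
  \<comment> \<open>Layer indices start at 1, list positions at 0.\<close>
  have "{1..layer_size ex \<eta> t} = Suc ` {..<length ?xs}"
    by (simp add: layer_size_def image_Suc_lessThan)
  then have "layer_elem ex \<eta> t ` {1..layer_size ex \<eta> t} = (!) ?xs ` {..<length ?xs}"
    by (simp add: image_image layer_elem_def del: length_sorted_list_of_set)
  also have "\<dots> = set ?xs" by (auto simp: set_conv_nth)
  finally show ?thesis using assms by simp
qed

lemma layer_elem_mem:
  assumes "finite ex" "p \<in> {1..layer_size ex \<eta> t}"
  shows "layer_elem ex \<eta> t p \<in> ex" "\<eta> (layer_elem ex \<eta> t p) = t"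
  using layer_elem_image[OF assms(1), of \<eta> t] assms(2) by blast+

lemma layer_elem_cases:
  assumes "finite ex" "j \<in> ex"
  obtains p where "p \<in> {1..layer_size ex \<eta> (\<eta> j)}" "j = layer_elem ex \<eta> (\<eta> j) p"
  using layer_elem_image[OF assms(1), of \<eta> "\<eta> j"] assms(2) by blast

lemma pred_idx_layer_elem:
  assumes fin: "finite ex" and p: "p \<in> {1..layer_size ex \<eta> t}"
  shows "pred_idx ex \<eta> (layer_elem ex \<eta> t p) =
    (if p = 1 then None else Some (layer_elem ex \<eta> t (p - 1)))"
proof -
  let ?J = "layer_elem ex \<eta> t" and ?l = "layer_size ex \<eta> t"
  have S: "{j\<in>ex. j < ?J p \<and> \<eta> j = \<eta> (?J p)} = ?J ` {1..<p}"
  proof -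
    have "{j\<in>ex. j < ?J p \<and> \<eta> j = \<eta> (?J p)} = {j \<in> ?J ` {1..?l}. j < ?J p}"
      using layer_elem_image[OF fin, of \<eta> t] layer_elem_mem[OF fin p] by auto
    also have "\<dots> = ?J ` {1..<p}"
      using layer_elem_less_iff[OF fin _ p] p by force
    finally show ?thesis .
  qed
  show ?thesis
  proof (cases "p = 1")
    case False
    have "Max (?J ` {1..<p}) = ?J (p - 1)"
    proof (rule Max_eqI)
      fix y assume "y \<in> ?J ` {1..<p}"
      then obtain q where q: "q \<in> {1..<p}" "y = ?J q" by blast
      then show "y \<le> ?J (p - 1)"
        using layer_elem_strict_mono[OF fin, of q "p - 1" \<eta> t] p
        by (cases "q = p - 1") (auto intro: less_imp_le)
    qed (use False p in auto)
    moreover have "{1..<p} \<noteq> {}" using False p by auto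
    ultimately show ?thesis using False by (simp add: pred_idx_def S Let_def)
  next
    case True
    then have "{1..<p} = {}" by simp
    with True show ?thesis unfolding pred_idx_def S by simp
  qed
qed

lemma succ_idx_layer_elem:
  assumes fin: "finite ex" and p: "p \<in> {1..layer_size ex \<eta> t}"
  shows "succ_idx ex \<eta> (layer_elem ex \<eta> t p) =
    (if p = layer_size ex \<eta> t then None else Some (layer_elem ex \<eta> t (p + 1)))"
proof -
  let ?J = "layer_elem ex \<eta> t" and ?l = "layer_size ex \<eta> t"
  have S: "{j\<in>ex. j > ?J p \<and> \<eta> j = \<eta> (?J p)} = ?J ` {p<..?l}"
  proof -
    have "{j\<in>ex. j > ?J p \<and> \<eta> j = \<eta> (?J p)} = {j \<in> ?J ` {1..?l}. j > ?J p}"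
      using layer_elem_image[OF fin, of \<eta> t] layer_elem_mem[OF fin p] by auto
    also have "\<dots> = ?J ` {p<..?l}"
      using layer_elem_less_iff[OF fin p] p by force
    finally show ?thesis .
  qed
  show ?thesis
  proof (cases "p = ?l")
    case False
    have "Min (?J ` {p<..?l}) = ?J (p + 1)"
    proof (rule Min_eqI)
      fix y assume "y \<in> ?J ` {p<..?l}"
      then obtain q where q: "q \<in> {p<..?l}" "y = ?J q" by blast
      then show "y \<ge> ?J (p + 1)"
        using layer_elem_strict_mono[OF fin, of "p + 1" q \<eta> t] p
        by (cases "q = p + 1") (auto intro: less_imp_le)
    qed (use False p in auto)
    moreover have "{p<..?l} \<noteq> {}" using False p by auto
    ultimately show ?thesis using False by (simp add: succ_idx_def S Let_def)
  next
    case True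
    then have "{p<..?l} = {}" by simp
    with True show ?thesis unfolding succ_idx_def S by simp
  qed
qed

text \<open>Identifies neighbours in a layer with neighbours in the Dynkin diagram of type A, so
  that the change of c-vectors can be matched with a simple reflection.\<close>

lemma layer_elem_adjacent_iff:
  assumes fin: "finite ex" and p: "p \<in> {1..layer_size ex \<eta> t}" and q: "q \<in> {1..layer_size ex \<eta> t}"
  shows "pred_idx ex \<eta> (layer_elem ex \<eta> t p) = Some (layer_elem ex \<eta> t q) \<or>
      succ_idx ex \<eta> (layer_elem ex \<eta> t p) = Some (layer_elem ex \<eta> t q)
    \<longleftrightarrow> p = q + 1 \<or> q = p + 1"
proof -
  have "pred_idx ex \<eta> (layer_elem ex \<eta> t p) = Some (layer_elem ex \<eta> t q) \<longleftrightarrow> p = q + 1"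
  proof (cases "p = 1")
    case False
    then have "p - 1 \<in> {1..layer_size ex \<eta> t}" using p by auto
    from layer_elem_eq_iff[OF fin this q] show ?thesis
      using False p by (auto simp: pred_idx_layer_elem[OF fin p])
  next
    case True
    then show ?thesis unfolding pred_idx_layer_elem[OF fin p] using q by simp
  qed
  moreover have "succ_idx ex \<eta> (layer_elem ex \<eta> t p) = Some (layer_elem ex \<eta> t q) \<longleftrightarrow> q = p + 1"
    using layer_elem_eq_iff[OF fin _ q, of "p + 1"] p q
    by (auto simp: succ_idx_layer_elem[OF fin p])
  ultimately show ?thesis by blast
qed

lemma same_layer_if_adjacent:
  assumes "finite ex" "pred_idx ex \<eta> k = Some j \<or> succ_idx ex \<eta> k = Some j"
  shows "\<eta> j = \<eta> k"
proof -
  have "\<eta> (Max S) = \<eta> k" "\<eta> (Min S) = \<eta> k" if "S \<subseteq> {j\<in>ex. \<eta> j = \<eta> k}" "S \<noteq> {}" for S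
  proof -
    have "finite S" using finite_subset[OF that(1)] assms(1) by simp
    then show "\<eta> (Max S) = \<eta> k" "\<eta> (Min S) = \<eta> k"
      using Max_in[of S] Min_in[of S] that by blast+
  qed
  from this[of "{j\<in>ex. j < k \<and> \<eta> j = \<eta> k}"] this[of "{j\<in>ex. j > k \<and> \<eta> j = \<eta> k}"] show ?thesis
    using assms(2) by (auto simp: pred_idx_def succ_idx_def Let_def split: if_splits)
qed

section \<open>Triangular words in the symmetric group\<close>

text \<open>These are the down-sets of the triangle under the precedence order of a triangular
  shuffle, that is, the sets of steps that may have been done at some moment. The guard
  \<open>1 \<le> i\<close> keeps column 0 out.\<close>

definition triangle_ideal :: "nat \<Rightarrow> (nat \<times> nat) set \<Rightarrow> bool" where
  "triangle_ideal l D \<longleftrightarrow> D \<subseteq> triangle l \<and>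
     (\<forall>n i. (n, i + 1) \<in> D \<longrightarrow> 1 \<le> i \<longrightarrow> (n, i) \<in> D) \<and>
     (\<forall>n i. (n, i) \<in> D \<longrightarrow> 2 \<le> n \<longrightarrow> (n - 1, i + 1) \<in> D)"

lemma triangle_ideal_bounds:
  assumes "triangle_ideal l D" "(n, i) \<in> D"
  shows "1 \<le> n" "1 \<le> i" "n + i \<le> l + 1"
  using assms unfolding triangle_ideal_def triangle_def by auto

lemma triangle_ideal_row:
  assumes "triangle_ideal l D" "(n, i) \<in> D" "1 \<le> x" "x \<le> i"
  shows "(n, x) \<in> D"
  using assms(4,2)
proof (induction i rule: dec_induct)
  case (step i)
  then show ?case using assms(1,3) unfolding triangle_ideal_def by auto
qed

lemma triangle_ideal_antidiagonal:
  assumes "triangle_ideal l D" "(n, i) \<in> D" "1 \<le> a" "a \<le> n"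
  shows "(a, n + i - a) \<in> D"
  using assms(4,2)
proof (induction n arbitrary: i rule: dec_induct)
  case (step n)
  then have "(n, i + 1) \<in> D" using assms(1,3) unfolding triangle_ideal_def by fastforce
  from step.IH[OF this] show ?case by simp
qed simp

text \<open>
  The step \<open>(n, i)\<close> of a triangular word exchanges the elements \<open>n\<close> and \<open>n + i\<close>, which are
  adjacent at that time, with \<open>n\<close> moving to the right. After the steps in \<open>D\<close> the element \<open>m\<close> has
  thus moved right once for every \<open>(m, i) \<in> D\<close> and left once for every \<open>(a, m - a) \<in> D\<close>.
\<close>

definition word_place :: "(nat \<times> nat) set \<Rightarrow> nat \<Rightarrow> nat" where
  "word_place D m = m + card {i. (m, i) \<in> D} - card {a. (a, m - a) \<in> D}"

lemma word_place_empty [simp]: "word_place {} m = m"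
  by (simp add: word_place_def)

text \<open>In the full triangle \<open>m\<close> moves right past all \<open>l + 1 - m\<close>
  larger elements and left past all \<open>m - 1\<close> smaller ones: the order is
  reversed.\<close>

lemma word_place_triangle:
  assumes "m \<in> {1..l + 1}"
  shows "word_place (triangle l) m = l + 2 - m"
proof -
  have "{i. (m, i) \<in> triangle l} = {1..l + 1 - m}"
    using assms by (auto simp: triangle_def)
  moreover have "{a. (a, m - a) \<in> triangle l} = {1..<m}"
    using assms by (auto simp: triangle_def)
  ultimately show ?thesis using assms by (simp add: word_place_def)
qed

text \<open>Just before the step, \<open>n\<close> has passed every smaller element and
  \<open>n + 1, ..., n + i - 1\<close>, hence stands at \<open>n - (n - 1) + (i - 1) = i\<close>.
  The element \<open>n + i\<close> has been passed exactly by \<open>1, ..., n - 1\<close>, hence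
  stands at \<open>i + 1\<close>. The closure conditions on the two ideals pin down these
  counts.\<close>

lemma word_place_step:
  assumes D: "triangle_ideal l D" and E: "triangle_ideal l (insert (n, i) D)"
    and new: "(n, i) \<notin> D"
  shows "word_place D n = i" "word_place D (n + i) = i + 1"
    "word_place (insert (n, i) D) n = i + 1" "word_place (insert (n, i) D) (n + i) = i"
    "\<And>m. m \<noteq> n \<Longrightarrow> m \<noteq> n + i \<Longrightarrow> word_place (insert (n, i) D) m = word_place D m"
proof -
  let ?E = "insert (n, i) D"
  have ni: "1 \<le> n" "1 \<le> i" using triangle_ideal_bounds[OF E] by auto
  have above: "(n - 1, i + 1) \<in> D" if "2 \<le> n"
  proof -
    have "(n - 1, i + 1) \<in> ?E" using E that unfolding triangle_ideal_def by blast
    with that show ?thesis by auto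
  qed
  have row_n: "{x. (n, x) \<in> D} = {1..<i}"
  proof (intro set_eqI iffI)
    fix x assume "x \<in> {1..<i}"
    then show "x \<in> {x. (n, x) \<in> D}" using triangle_ideal_row[OF E, of n i x] by auto
  next
    fix x assume "x \<in> {x. (n, x) \<in> D}"
    then have "(n, x) \<in> D" by simp
    then show "x \<in> {1..<i}"
      using triangle_ideal_row[OF D, of n x i] triangle_ideal_bounds[OF D, of n x] ni new
      by (cases "x < i") auto
  qed
  have anti_n: "{a. (a, n - a) \<in> D} = {1..<n}"
  proof (intro set_eqI iffI)
    fix a assume a: "a \<in> {1..<n}"
    then have "(n - 1, 1) \<in> D" using above triangle_ideal_row[OF D, of "n - 1" "i + 1" 1] by auto
    then show "a \<in> {a. (a, n - a) \<in> D}"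
      using triangle_ideal_antidiagonal[OF D, of "n - 1" 1 a] a by auto
  next
    fix a assume "a \<in> {a. (a, n - a) \<in> D}"
    \<comment> \<open>For \<open>a \<ge> n\<close> truncated subtraction gives second component 0,
      which no pair in the triangle has.\<close>
    then show "a \<in> {1..<n}" using triangle_ideal_bounds[OF D, of a "n - a"] by auto
  qed
  have row_ni: "{x. (n + i, x) \<in> D} = {}"
  proof -
    \<comment> \<open>A right move of \<open>n + i\<close> would force \<open>(n + i, 1)\<close>,
      then \<open>(n, i + 1)\<close> on its antidiagonal, then the new step \<open>(n, i)\<close>
      itself.\<close>
    have False if x: "(n + i, x) \<in> D" for x
    proof -
      have "(n + i, 1) \<in> D"
        using triangle_ideal_row[OF D x] triangle_ideal_bounds[OF D x] by auto
      then have "(n, i + 1) \<in> D"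
        using triangle_ideal_antidiagonal[OF D, of "n + i" 1 n] ni by auto
      then show False using triangle_ideal_row[OF D, of n "i + 1" i] ni new by auto
    qed
    then show ?thesis by blast
  qed
  have anti_ni: "{a. (a, n + i - a) \<in> D} = {1..<n}"
  proof (intro set_eqI iffI)
    fix a assume a: "a \<in> {1..<n}"
    then show "a \<in> {a. (a, n + i - a) \<in> D}"
      using above triangle_ideal_antidiagonal[OF D, of "n - 1" "i + 1" a] by auto
  next
    fix a assume "a \<in> {a. (a, n + i - a) \<in> D}"
    then have a: "(a, n + i - a) \<in> D" by simp
    \<comment> \<open>Otherwise descending this antidiagonal to row \<open>n\<close> would put
      \<open>(n, i)\<close> in \<open>D\<close>.\<close>
    have "\<not> n \<le> a"
      using triangle_ideal_antidiagonal[OF D a, of n] triangle_ideal_bounds[OF D a] ni new by auto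
    then show "a \<in> {1..<n}" using triangle_ideal_bounds[OF D a] by auto
  qed
  show "word_place D n = i" "word_place D (n + i) = i + 1"
    using ni by (auto simp: word_place_def row_n anti_n row_ni anti_ni)
  have "{x. (n, x) \<in> ?E} = insert i {x. (n, x) \<in> D}"
    "{a. (a, n - a) \<in> ?E} = {a. (a, n - a) \<in> D}" using ni by auto
  then have "{x. (n, x) \<in> ?E} = {1..i}" "{a. (a, n - a) \<in> ?E} = {1..<n}"
    unfolding row_n anti_n using ni by auto
  then show "word_place ?E n = i + 1" using ni by (simp add: word_place_def)
  have "{x. (n + i, x) \<in> ?E} = {x. (n + i, x) \<in> D}"
    "{a. (a, n + i - a) \<in> ?E} = insert n {a. (a, n + i - a) \<in> D}" using ni by auto
  then have "{x. (n + i, x) \<in> ?E} = {}" "{a. (a, n + i - a) \<in> ?E} = {1..n}"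
    unfolding row_ni anti_ni using ni by auto
  then show "word_place ?E (n + i) = i" using ni by (simp add: word_place_def)
  fix m assume "m \<noteq> n" "m \<noteq> n + i"
  then have "{x. (m, x) \<in> ?E} = {x. (m, x) \<in> D}" "{a. (a, m - a) \<in> ?E} = {a. (a, m - a) \<in> D}"
    using ni by auto
  then show "word_place ?E m = word_place D m" by (simp add: word_place_def)
qed

text \<open>
  \<open>c p x\<close> is the coefficient of the \<open>x\<close>-th simple root in the root \<open>e\<^sub>w\<^sub>(\<^sub>p\<^sub>) - e\<^sub>w\<^sub>(\<^sub>p\<^sub>+\<^sub>1\<^sub>)\<close>, where
  \<open>w\<close> is the permutation reached after the steps in \<open>D\<close>.
\<close>

definition root_state :: "nat \<Rightarrow> (nat \<times> nat) set \<Rightarrow> (nat \<Rightarrow> nat \<Rightarrow> int) \<Rightarrow> bool" where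
  "root_state l D c \<longleftrightarrow>
     (\<exists>w. (\<forall>m\<in>{1..l + 1}. w (word_place D m) = m) \<and>
          (\<forall>p\<in>{1..l}. \<forall>x\<in>{1..l}. c p x = of_bool (w p \<le> x) - of_bool (w (p + 1) \<le> x)))"

lemma root_state_empty:
  assumes "\<And>p x. p \<in> {1..l} \<Longrightarrow> x \<in> {1..l} \<Longrightarrow> c p x = of_bool (x = p)"
  shows "root_state l {} c"
  unfolding root_state_def by (rule exI[of _ id]) (use assms in auto)

text \<open>The final permutation is decreasing, so every simple root has become negative.\<close>

lemma root_state_triangle:
  assumes "root_state l (triangle l) c" "p \<in> {1..l}" "x \<in> {1..l}"
  shows "c p x \<le> 0"
proof -
  obtain w where w: "\<And>m. m \<in> {1..l + 1} \<Longrightarrow> w (word_place (triangle l) m) = m"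
    and c: "c p x = of_bool (w p \<le> x) - of_bool (w (p + 1) \<le> x)"
    using assms unfolding root_state_def by blast
  have m: "l + 2 - p \<in> {1..l + 1}" "l + 1 - p \<in> {1..l + 1}" using assms(2) by auto
  have "w p = l + 2 - p" "w (p + 1) = l + 1 - p"
    using m[THEN w] m[THEN word_place_triangle] assms(2) by (simp_all add: Suc_diff_le)
  then show ?thesis using c by auto
qed

text \<open>The places \<open>i\<close> and \<open>i + 1\<close> hold \<open>n < n + i\<close>
  before the step, so the root there is positive.\<close>

lemma root_state_nonneg:
  assumes c: "root_state l D c"
    and D: "triangle_ideal l D" "triangle_ideal l (insert (n, i) D)" "(n, i) \<notin> D"
    and x: "x \<in> {1..l}"
  shows "c i x \<ge> 0"
proof -
  obtain w where w: "\<And>m. m \<in> {1..l + 1} \<Longrightarrow> w (word_place D m) = m"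
    and c: "\<And>p. p \<in> {1..l} \<Longrightarrow> c p x = of_bool (w p \<le> x) - of_bool (w (p + 1) \<le> x)"
    using c x unfolding root_state_def by blast
  have ni: "1 \<le> n" "1 \<le> i" "n + i \<le> l + 1" using triangle_ideal_bounds[OF D(2)] by auto
  have "w i = n" "w (i + 1) = n + i"
    using w[of n] w[of "n + i"] word_place_step(1,2)[OF D] ni by auto
  then show ?thesis using c[of i] ni by auto
qed

text \<open>The assumed update is the action of \<open>s\<^sub>i\<close> on simple roots: the
  \<open>i\<close>-th is negated and added to its neighbours. It therefore amounts to replacing
  \<open>w\<close> by \<open>w s\<^sub>i\<close>.\<close>

lemma root_state_insert:
  assumes c: "root_state l D c"
    and D: "triangle_ideal l D" "triangle_ideal l (insert (n, i) D)" "(n, i) \<notin> D"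
    and c': "\<And>p x. p \<in> {1..l} \<Longrightarrow> x \<in> {1..l} \<Longrightarrow> c' p x =
      (if p = i then - c p x else if i = p + 1 \<or> p = i + 1 then c p x + c i x else c p x)"
  shows "root_state l (insert (n, i) D) c'"
proof -
  obtain w where w: "\<And>m. m \<in> {1..l + 1} \<Longrightarrow> w (word_place D m) = m"
    and c: "\<And>p x. p \<in> {1..l} \<Longrightarrow> x \<in> {1..l} \<Longrightarrow>
      c p x = of_bool (w p \<le> x) - of_bool (w (p + 1) \<le> x)"
    using c unfolding root_state_def by blast
  have ni: "1 \<le> n" "1 \<le> i" "n + i \<le> l + 1" using triangle_ideal_bounds[OF D(2)] by auto
  have wi: "w i = n" "w (i + 1) = n + i"
    using w[of n] w[of "n + i"] word_place_step(1,2)[OF D] ni by auto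
  define w' where "w' = w(i := n + i, i + 1 := n)"
  have "w' (word_place (insert (n, i) D) m) = m" if m: "m \<in> {1..l + 1}" for m
  proof -
    consider "m = n" | "m = n + i" | "m \<noteq> n" "m \<noteq> n + i" by blast
    then show ?thesis
    proof cases
      case 3
      \<comment> \<open>The two exchanged places are occupied by \<open>n\<close> and
        \<open>n + i\<close>, so every other element stands elsewhere.\<close>
      then have "word_place D m \<noteq> i" "word_place D m \<noteq> i + 1" using w[OF m] wi by auto
      then show ?thesis using 3 w[OF m] word_place_step(5)[OF D 3] by (simp add: w'_def)
    qed (use word_place_step(3,4)[OF D] in \<open>auto simp: w'_def\<close>)
  qed
  moreover have "c' p x = of_bool (w' p \<le> x) - of_bool (w' (p + 1) \<le> x)"
    if px: "p \<in> {1..l}" "x \<in> {1..l}" for p x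
    using c'[OF px] c[OF px] c[of i x] px ni wi by (auto simp: w'_def)
  ultimately show ?thesis unfolding root_state_def by blast
qed

section \<open>Full layered T-systems\<close>

text \<open>The positions and the bound \<open>q\<close> will refer to the subsequence of one layer,
  not to the whole mutation sequence.\<close>

definition steps_before :: "nat \<Rightarrow> (nat \<times> nat \<Rightarrow> nat) \<Rightarrow> nat \<Rightarrow> (nat \<times> nat) set" where
  "steps_before l pos q = {s \<in> triangle l. pos s < q}"

lemma triangle_ideal_steps_before:
  assumes row: "\<forall>(n, i) \<in> triangle l. (n, i + 1) \<in> triangle l \<longrightarrow> pos (n, i) < pos (n, i + 1)"
    and anti: "\<forall>(n, i) \<in> triangle l. n \<ge> 2 \<longrightarrow> pos (n - 1, i + 1) < pos (n, i)"
  shows "triangle_ideal l (steps_before l pos q)"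
  unfolding triangle_ideal_def
proof (intro conjI allI impI)
  fix n i assume *: "(n, i + 1) \<in> steps_before l pos q" "1 \<le> i"
  then have "(n, i) \<in> triangle l" by (auto simp: steps_before_def triangle_def)
  with * row show "(n, i) \<in> steps_before l pos q" by (fastforce simp: steps_before_def)
next
  fix n i assume *: "(n, i) \<in> steps_before l pos q" "2 \<le> n"
  then have "(n - 1, i + 1) \<in> triangle l" by (auto simp: steps_before_def triangle_def)
  with * anti show "(n - 1, i + 1) \<in> steps_before l pos q" by (fastforce simp: steps_before_def)
qed (auto simp: steps_before_def)

lemma steps_before_Suc:
  assumes "inj_on pos (triangle l)" "s \<in> triangle l"
  shows "steps_before l pos (Suc (pos s)) = insert s (steps_before l pos (pos s))"
  using assms by (auto simp: steps_before_def less_Suc_eq dest: inj_onD)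

theorem theorem2:
  fixes N :: nat and ex :: "nat set" and b :: "nat \<Rightarrow> nat \<Rightarrow> int"
    and \<eta> :: "nat \<Rightarrow> int" and ks :: "nat list"
  assumes "ex \<subseteq> {1..N}"
    and "skew_symmetrizable ex b"
    and "full_layered_T_system ex \<eta> b ks"
  shows "maximal_green_sequence ex b ks"
proof -
  have fin: "finite ex" using assms(1) finite_subset by blast
  have layered: "layered_T_system ex \<eta> b ks"
    using assms(3) unfolding full_layered_T_system_def by blast
  then have ks: "set ks \<subseteq> ex" unfolding layered_T_system_def by blast
  then have ks_mem: "ks ! s \<in> ex" if "s < length ks" for s using that by auto
  let ?l = "layer_size ex \<eta>" and ?J = "layer_elem ex \<eta>"
  \<comment> \<open>The length of \<open>F t s\<close> is the local clock of layer \<open>t\<close>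
    after \<open>s\<close> mutations.\<close>
  define F where "F t s = filter (\<lambda>k. \<eta> k = t) (take s ks)" for t s
  have F_all: "F t (length ks) = filter (\<lambda>k. \<eta> k = t) ks" for t by (simp add: F_def)
  have "\<forall>t\<in>\<eta> ` ex. triangular_shuffle (?l t) (?J t) (F t (length ks))"
    using assms(3) unfolding full_layered_T_system_def F_all by blast
  then obtain pos where
    bij: "\<And>t. t \<in> \<eta> ` ex \<Longrightarrow> bij_betw (pos t) (triangle (?l t)) {..<length (F t (length ks))}"
    and elem: "\<And>t. t \<in> \<eta> ` ex \<Longrightarrow>
      \<forall>(n, i) \<in> triangle (?l t). F t (length ks) ! pos t (n, i) = ?J t i"
    and row: "\<And>t. t \<in> \<eta> ` ex \<Longrightarrow> \<forall>(n, i) \<in> triangle (?l t).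
      (n, i + 1) \<in> triangle (?l t) \<longrightarrow> pos t (n, i) < pos t (n, i + 1)"
    and anti: "\<And>t. t \<in> \<eta> ` ex \<Longrightarrow> \<forall>(n, i) \<in> triangle (?l t).
      n \<ge> 2 \<longrightarrow> pos t (n - 1, i + 1) < pos t (n, i)"
    unfolding triangular_shuffle_def bchoice_iff by blast
  define D where "D t s = steps_before (?l t) (pos t) (length (F t s))" for t s
  have ideal: "triangle_ideal (?l t) (D t s)" if "t \<in> \<eta> ` ex" for t s
    unfolding D_def using triangle_ideal_steps_before row anti that by blast
  have D_Suc: "\<exists>n i. ks ! s = ?J t i \<and> i \<in> {1..?l t} \<and>
      (n, i) \<notin> D t s \<and> D t (Suc s) = insert (n, i) (D t s)"
    if s: "s < length ks" and t: "t = \<eta> (ks ! s)" for t s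
  proof -
    have tex: "t \<in> \<eta> ` ex" using t ks_mem[OF s] by auto
    have Suc: "F t (Suc s) = F t s @ [ks ! s]"
      using s t by (simp add: F_def take_Suc_conv_app_nth)
    have "F t (length ks) = F t (Suc s) @ filter (\<lambda>k. \<eta> k = t) (drop (Suc s) ks)"
      unfolding F_def by (metis append_take_drop_id filter_append order_refl take_all)
    then have len: "length (F t s) < length (F t (length ks))"
      and nth: "F t (length ks) ! length (F t s) = ks ! s"
      using Suc by auto
    \<comment> \<open>The current mutation sits at position \<open>length (F t s)\<close> of its
      layer's subsequence; surjectivity of \<open>pos t\<close> tells which step of the triangle it
      is.\<close>
    obtain n i where ni: "(n, i) \<in> triangle (?l t)" "pos t (n, i) = length (F t s)"
      using bij_betw_imp_surj_on[OF bij[OF tex]] len by (metis (no_types) imageE lessThan_iff surj_pair)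
    have "ks ! s = ?J t i" using elem[OF tex] ni nth by auto
    moreover have "i \<in> {1..?l t}" using ni by (auto simp: triangle_def)
    moreover have "D t (Suc s) = insert (n, i) (D t s)"
      using steps_before_Suc[OF bij_betw_imp_inj_on[OF bij[OF tex]] ni(1)] ni(2) Suc
      by (simp add: D_def)
    moreover have "(n, i) \<notin> D t s" using ni by (simp add: D_def steps_before_def)
    ultimately show ?thesis by blast
  qed
  have D_other: "D t (Suc s) = D t s" if "s < length ks" "t \<noteq> \<eta> (ks ! s)" for t s
    using that by (simp add: D_def F_def take_Suc_conv_app_nth)
  have D_0: "D t 0 = {}" for t by (simp add: D_def F_def steps_before_def)
  have D_all: "D t (length ks) = triangle (?l t)" if "t \<in> \<eta> ` ex" for t
    using bij_betw_imp_surj_on[OF bij[OF that]] by (auto simp: D_def steps_before_def)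
  define c where "c s = c_vector b (take s ks)" for s
  \<comment> \<open>The invariant: inside a layer the c-vectors are the roots of the current
    permutation, and no c-vector has a nonzero coordinate outside its own layer.\<close>
  define good where "good s \<longleftrightarrow>
    (\<forall>t\<in>\<eta> ` ex. root_state (?l t) (D t s) (\<lambda>p x. c s (?J t p) (?J t x))) \<and>
    (\<forall>j\<in>ex. \<forall>y\<in>ex. \<eta> y \<noteq> \<eta> j \<longrightarrow> c s j y = 0)" for s
  \<comment> \<open>Derived from the invariant before the latter is established: its induction step
    needs this sign to apply the mutation rule, and greenness follows from it at the end.\<close>
  have nonneg: "c s (ks ! s) y \<ge> 0" if s: "s < length ks" and "good s" and y: "y \<in> ex" for s y
  proof (cases "\<eta> y = \<eta> (ks ! s)")
    case True
    define t where "t = \<eta> (ks ! s)"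
    have tex: "t \<in> \<eta> ` ex" using t_def ks_mem[OF s] by auto
    obtain n i where ni: "ks ! s = ?J t i" "(n, i) \<notin> D t s" "D t (Suc s) = insert (n, i) (D t s)"
      using D_Suc[OF s t_def] by blast
    obtain x where x: "x \<in> {1..?l t}" "y = ?J t x"
      using layer_elem_cases[OF fin y, of \<eta>] True t_def by metis
    have "root_state (?l t) (D t s) (\<lambda>p x. c s (?J t p) (?J t x))"
      using \<open>good s\<close> tex unfolding good_def by blast
    from root_state_nonneg[OF this ideal[OF tex] _ ni(2) x(1)] show ?thesis
      using ideal[OF tex, of "Suc s"] ni x by simp
  next
    case False
    then show ?thesis using ks_mem[OF s] \<open>good s\<close> y unfolding good_def by auto
  qed
  have good: "good s" if "s \<le> length ks" for s
    using that
  proof (induction s)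
    case 0
    have "root_state (?l t) {} (\<lambda>p x. c 0 (?J t p) (?J t x))" for t
      by (rule root_state_empty) (simp add: c_def c_vector_Nil layer_elem_eq_iff[OF fin])
    then show ?case by (auto simp: good_def D_0 c_def c_vector_Nil)
  next
    case (Suc s)
    then have s: "s < length ks" and "good s" by auto
    define k where "k = ks ! s"
    have kex: "k \<in> ex" using k_def ks_mem[OF s] by simp
    have step: "c (Suc s) j y = (if j = k then - c s j y
       else if pred_idx ex \<eta> k = Some j \<or> succ_idx ex \<eta> k = Some j then c s j y + c s k y
       else c s j y)" if "j \<in> ex" "y \<in> ex" for j y
      unfolding c_def
      by (rule layered_T_system_c_vector_step[OF assms(2) layered s k_def _ that(1)])
        (use nonneg[OF s \<open>good s\<close> that(2)] in \<open>simp add: c_def k_def\<close>)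
    have "root_state (?l t) (D t (Suc s)) (\<lambda>p x. c (Suc s) (?J t p) (?J t x))"
      if tex: "t \<in> \<eta> ` ex" for t
    proof (cases "t = \<eta> k")
      case True
      then obtain n i where ni: "k = ?J t i" "i \<in> {1..?l t}" "(n, i) \<notin> D t s"
        "D t (Suc s) = insert (n, i) (D t s)"
        using D_Suc[OF s] k_def by metis
      have "root_state (?l t) (D t s) (\<lambda>p x. c s (?J t p) (?J t x))"
        using \<open>good s\<close> tex unfolding good_def by blast
      then show ?thesis
        unfolding ni(4)
      proof (rule root_state_insert)
        show "triangle_ideal (?l t) (D t s)" "triangle_ideal (?l t) (insert (n, i) (D t s))"
          using ideal[OF tex] ni(4) by metis+
        fix p x assume px: "p \<in> {1..?l t}" "x \<in> {1..?l t}"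
        show "c (Suc s) (?J t p) (?J t x) = (if p = i then - c s (?J t p) (?J t x)
          else if i = p + 1 \<or> p = i + 1 then c s (?J t p) (?J t x) + c s (?J t i) (?J t x)
          else c s (?J t p) (?J t x))"
          using step[OF layer_elem_mem(1)[OF fin px(1)] layer_elem_mem(1)[OF fin px(2)]]
          unfolding ni(1) layer_elem_adjacent_iff[OF fin ni(2) px(1)]
            layer_elem_eq_iff[OF fin px(1) ni(2)] .
      qed (rule ni(3))
    next
      case False
      \<comment> \<open>The neighbours of \<open>k\<close> share its layer, so c-vectors of other
        layers do not change.\<close>
      have "c (Suc s) (?J t p) (?J t x) = c s (?J t p) (?J t x)"
        if px: "p \<in> {1..?l t}" "x \<in> {1..?l t}" for p x
        using step[OF layer_elem_mem(1)[OF fin px(1)] layer_elem_mem(1)[OF fin px(2)]]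
          layer_elem_mem(2)[OF fin px(1)] same_layer_if_adjacent[OF fin, of \<eta> k "?J t p"] False
        by auto
      moreover have "root_state (?l t) (D t s) (\<lambda>p x. c s (?J t p) (?J t x))"
        using \<open>good s\<close> tex unfolding good_def by blast
      moreover have "D t (Suc s) = D t s" using D_other[OF s] False k_def by blast
      ultimately show ?thesis by (simp add: root_state_def)
    qed
    moreover have "c (Suc s) j y = 0" if "j \<in> ex" "y \<in> ex" "\<eta> y \<noteq> \<eta> j" for j y
    proof -
      \<comment> \<open>The c-vector of \<open>k\<close> is added only within its layer, where its
        coordinate at \<open>y\<close> vanishes as well.\<close>
      have "c s j y = 0" "\<eta> k = \<eta> j \<Longrightarrow> c s k y = 0"
        using \<open>good s\<close> that kex unfolding good_def by auto
      then show ?thesis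
        using step[OF that(1,2)] same_layer_if_adjacent[OF fin, of \<eta> k j] by auto
    qed
    ultimately show ?case unfolding good_def by blast
  qed
  have "c (length ks) j y \<le> 0" if j: "j \<in> ex" and y: "y \<in> ex" for j y
  proof (cases "\<eta> y = \<eta> j")
    case True
    obtain p where p: "p \<in> {1..?l (\<eta> j)}" "j = ?J (\<eta> j) p"
      using layer_elem_cases[OF fin j] .
    obtain x where x: "x \<in> {1..?l (\<eta> j)}" "y = ?J (\<eta> j) x"
      using layer_elem_cases[OF fin y, of \<eta>] True by metis
    have "root_state (?l (\<eta> j)) (triangle (?l (\<eta> j)))
        (\<lambda>p x. c (length ks) (?J (\<eta> j) p) (?J (\<eta> j) x))"
      using good[of "length ks"] D_all j unfolding good_def by fastforce
    from root_state_triangle[OF this p(1) x(1)] show ?thesis using p x by simp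
  next
    case False
    then show ?thesis using good[of "length ks"] j y unfolding good_def by auto
  qed
  then have "red ex b ks j" if "j \<in> ex" for j
    using that by (simp add: red_def c_def)
  moreover have "green ex b (take s ks) (ks ! s)" if "s < length ks" for s
    using nonneg[OF that good] that by (simp add: green_def c_def)
  ultimately show ?thesis using ks unfolding maximal_green_sequence_def by blast
qed

end
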